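(* Suppose that $M=(E,\mathcal{I})$ is a finitary matroid and $B_0$ and $B_1$ are bases of $M$. Then there is a bijection $F:[B_0]^{<\aleph_0}\rightarrow[B_1]^{<\aleph_0}$ such that $(B_0\setminus I)\cup F(I)$ is a base of $M$ for every $I\in[B_0]^{<\aleph_0}$.
   Context: A finitary matroid is a pair $M=(E,\mathcal{I})$ with $\mathcal{I}\subseteq\mathcal{P}(E)$ ($E$ may be infinite) such that: (I) $\emptyset\in\mathcal{I}$; (II) $\mathcal{I}$ is downward closed under $\subseteq$; (III) if $I,J\in\mathcal{I}$ with $|I|<|J|$, then there is an $e\in J\setminus I$ such that $I\cup\{e\}\in\mathcal{I}$; (IV) if all finite subsets of an infinite set $X\subseteq E$ are in $\mathcal{I}$, then $X\in\mathcal{I}$. A base of $M$ is a $\subseteq$-maximal element of $\mathcal{I}$. For a set $X$, $[X]^{<\aleph_0}$ denotes the set of finite subsets of $X$. *)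

theory Defs
  imports Main "HOL-Library.Equipollence"
begin

text \<open>
  The cardinality comparison in the augmentation axiom is one of arbitrary, possibly infinite,
  cardinals, hence the strict comparison of sets by injections rather than
  the function \<open>card\<close>, which is 0 on infinite sets.
\<close>

locale finitary_matroid =
  fixes E :: "'a set" and \<I> :: "'a set set"
  assumes indep_subset_carrier: "\<I> \<subseteq> Pow E"
    and indep_empty: "{} \<in> \<I>"
    and indep_downward_closed: "J \<in> \<I> \<Longrightarrow> I \<subseteq> J \<Longrightarrow> I \<in> \<I>"
    and indep_augment: "I \<in> \<I> \<Longrightarrow> J \<in> \<I> \<Longrightarrow> I \<prec> J \<Longrightarrow> \<exists>e \<in> J - I. I \<union> {e} \<in> \<I>"
    and indep_finitary: "X \<subseteq> E \<Longrightarrow> infinite X \<Longrightarrow> (\<And>Y. Y \<subseteq> X \<Longrightarrow> finite Y \<Longrightarrow> Y \<in> \<I>) \<Longrightarrow> X \<in> \<I>"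

definition matroid_base :: "'a set set \<Rightarrow> 'a set \<Rightarrow> bool" where
  "matroid_base \<I> B \<longleftrightarrow> B \<in> \<I> \<and> (\<forall>J\<in>\<I>. B \<subseteq> J \<longrightarrow> J = B)"

end

theory Submission
  imports Defs "HOL-Library.Countable_Set"
begin

text \<open>
  Let \<open>e \<in> B\<^sub>0\<close> and \<open>f \<in> B\<^sub>1\<close> be such that exchanging them turns both \<open>B\<^sub>0\<close> and \<open>B\<^sub>1\<close> into bases.
  Then \<open>B\<^sub>0 - {e}\<close> and \<open>B\<^sub>1 - {f}\<close> are bases of both \<open>M/e\<close> and \<open>M/f\<close>; a bijection for \<open>M/e\<close>
  handles the sets \<open>I\<close> without \<open>e\<close> (sent to sets without \<open>f\<close>), and one for \<open>M/f\<close> handles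
  those with \<open>e\<close> (sent to sets with \<open>f\<close>). If the bases are countable, iterating this back and
  forth exhausts both of them along every branch, and the image of a finite set is
  determined after finitely many steps. In general, every element of a base lies in a countable
  set \<open>K\<close> spanned by each of \<open>K \<inter> B\<^sub>0\<close> and \<open>K \<inter> B\<^sub>1\<close>, so a bijection between the finite
  subsets of \<open>A\<^sub>0 \<subseteq> B\<^sub>0\<close> and \<open>A\<^sub>1 \<subseteq> B\<^sub>1\<close> with the same span extends by a countable piece, and
  Zorn's lemma yields a full one.
\<close>

section \<open>Closure in finitary matroids\<close>

text \<open>Only meaningful for \<^term>\<open>Y \<in> \<I>\<close>; elements outside the ground set lie in every closure.\<close>

definition cl :: "'a set set \<Rightarrow> 'a set \<Rightarrow> 'a set" where
  "cl \<I> Y = {x. x \<in> Y \<or> insert x Y \<notin> \<I>}"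

lemma cl_superset: "Y \<subseteq> cl \<I> Y"
  by (auto simp: cl_def)

lemma matroid_base_indep: "matroid_base \<I> B \<Longrightarrow> B \<in> \<I>"
  by (simp add: matroid_base_def)

section \<open>Finite supports and transitivity of closure\<close>

context finitary_matroid
begin

text \<open>Frees finitarity of its side conditions: a finite set is a finite subset of itself, and
  independent singletons force \<open>X\<close> into the ground set.\<close>

lemma indep_if_finite_subsets_indep:
  assumes "\<And>Y. Y \<subseteq> X \<Longrightarrow> finite Y \<Longrightarrow> Y \<in> \<I>"
  shows "X \<in> \<I>"
proof (cases "finite X")
  case False
  have "{x} \<in> \<I>" if "x \<in> X" for x
    using assms that by simp
  then have "X \<subseteq> E"
    using indep_subset_carrier by fastforce
  then show ?thesis
    using assms False indep_finitary by blast
qed (simp add: assms)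

lemma finite_augment:
  assumes "I \<in> \<I>" "J \<in> \<I>" "finite I" "finite J" "card I < card J"
  shows "\<exists>e \<in> J - I. insert e I \<in> \<I>"
proof -
  have "I \<prec> J"
    using assms by (simp add: lesspoll_def lepoll_iff_card_le eqpoll_iff_card)
  then show ?thesis
    using indep_augment[OF assms(1,2)] by simp
qed

text \<open>By finitarity a dependent \<open>insert x Y\<close> has a finite dependent subset;
  deleting \<open>x\<close> from it leaves the support.\<close>

lemma cl_finite_support:
  assumes "Y \<in> \<I>" "x \<in> cl \<I> Y"
  obtains Z where "Z \<subseteq> Y" "finite Z" "x \<in> cl \<I> Z"
proof (cases "x \<in> Y")
  case True
  then show ?thesis
    using that[of "{x}"] by (auto simp: cl_def)
next
  case False
  then have "insert x Y \<notin> \<I>"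
    using assms by (simp add: cl_def)
  then obtain W where W: "W \<subseteq> insert x Y" "finite W" "W \<notin> \<I>"
    using indep_if_finite_subsets_indep by blast
  have "insert x (W - {x}) \<notin> \<I>"
    using W(3) indep_downward_closed by blast
  then show ?thesis
    using that[of "W - {x}"] W by (auto simp: cl_def)
qed

lemma cl_mono: "Y \<subseteq> Z \<Longrightarrow> cl \<I> Y \<subseteq> cl \<I> Z"
  unfolding cl_def using indep_downward_closed by blast

text \<open>Enlarge \<open>Z\<close> to a maximal independent \<open>W\<close> inside
  \<open>Z \<union> Y\<close>. As \<open>Y\<close> spans \<open>W\<close>, it is no smaller, so an
  independent \<open>insert x Y\<close> would augment \<open>W\<close>. The new element is not
  \<open>x\<close>, because \<open>insert x Z\<close> is dependent, and an element of
  \<open>Y\<close> contradicts maximality.\<close>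

lemma cl_trans_finite:
  assumes Y: "Y \<in> \<I>" "finite Y" and Z: "Z \<in> \<I>" "finite Z"
    and sub: "Z \<subseteq> cl \<I> Y" and x: "x \<in> cl \<I> Z"
  shows "x \<in> cl \<I> Y"
proof (rule ccontr)
  assume "x \<notin> cl \<I> Y"
  then have xY: "insert x Y \<in> \<I>" "x \<notin> Y"
    by (auto simp: cl_def)
  then have dep: "insert x Z \<notin> \<I>"
    using x sub \<open>x \<notin> cl \<I> Y\<close> by (auto simp: cl_def)
  define S where "S = {W \<in> \<I>. Z \<subseteq> W \<and> W \<subseteq> Z \<union> Y}"
  have "finite S"
    by (rule finite_subset[of _ "Pow (Z \<union> Y)"]) (use Y Z in \<open>auto simp: S_def\<close>)
  moreover have "Z \<in> S"
    using Z by (simp add: S_def)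
  ultimately obtain W where W: "W \<in> S" and max: "\<And>V. V \<in> S \<Longrightarrow> W \<subseteq> V \<Longrightarrow> V = W"
    by (metis finite_has_maximal2)
  have fW: "finite W" "W \<in> \<I>" "W \<subseteq> cl \<I> Y" "Z \<subseteq> W" "W \<subseteq> Z \<union> Y"
    using W Y Z sub cl_superset[of Y \<I>] by (auto simp: S_def intro: finite_subset[of W "Z \<union> Y"])
  have "\<not> card Y < card W"
    using finite_augment[of Y W] fW Y by (auto simp: cl_def)
  then have "card W < card (insert x Y)"
    using Y xY by simp
  then obtain e where e: "e \<in> insert x Y - W" "insert e W \<in> \<I>"
    using finite_augment[of W "insert x Y"] fW Y xY by auto
  have "e \<noteq> x"
    using e dep indep_downward_closed fW by blast
  then have "insert e W \<in> S"
    using e fW by (auto simp: S_def)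
  then show False
    using max[of "insert e W"] e by auto
qed

text \<open>Reduces to \<open>cl_trans_finite\<close>: a finite \<open>Z'\<close> supports
  \<open>x\<close>, and the union of finitely many finite supports in \<open>Y\<close> spans
  \<open>Z'\<close>.\<close>

lemma cl_trans:
  assumes Y: "Y \<in> \<I>" and Z: "Z \<in> \<I>" and sub: "Z \<subseteq> cl \<I> Y"
  shows "cl \<I> Z \<subseteq> cl \<I> Y"
proof
  fix x assume "x \<in> cl \<I> Z"
  then obtain Z' where Z': "Z' \<subseteq> Z" "finite Z'" "x \<in> cl \<I> Z'"
    by (rule cl_finite_support[OF Z])
  have "\<exists>V. V \<subseteq> Y \<and> finite V \<and> z \<in> cl \<I> V" if "z \<in> Z'" for z
  proof -
    have "z \<in> cl \<I> Y"
      using that Z' sub by blast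
    then show ?thesis
      by (rule cl_finite_support[OF Y]) blast
  qed
  then obtain V where V: "\<And>z. z \<in> Z' \<Longrightarrow> V z \<subseteq> Y \<and> finite (V z) \<and> z \<in> cl \<I> (V z)"
    by metis
  define Y' where "Y' = (\<Union>z\<in>Z'. V z)"
  have Y': "Y' \<subseteq> Y" "finite Y'"
    using V Z' by (auto simp: Y'_def)
  have "Z' \<subseteq> cl \<I> Y'"
  proof
    fix z assume "z \<in> Z'"
    then have "z \<in> cl \<I> (V z)" "V z \<subseteq> Y'"
      using V by (auto simp: Y'_def)
    then show "z \<in> cl \<I> Y'"
      using cl_mono by blast
  qed
  moreover have "Y' \<in> \<I>" "Z' \<in> \<I>"
    using indep_downward_closed[OF Y Y'(1)] indep_downward_closed[OF Z Z'(1)] .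
  ultimately have "x \<in> cl \<I> Y'"
    using cl_trans_finite Y' Z' by blast
  then show "x \<in> cl \<I> Y"
    using cl_mono[OF Y'(1)] by auto
qed

lemma matroid_base_iff_cl: "matroid_base \<I> B \<longleftrightarrow> B \<in> \<I> \<and> cl \<I> B = UNIV"
proof
  assume "matroid_base \<I> B"
  then show "B \<in> \<I> \<and> cl \<I> B = UNIV"
    by (auto simp: matroid_base_def cl_def)
next
  assume B: "B \<in> \<I> \<and> cl \<I> B = UNIV"
  have "J = B" if "J \<in> \<I>" "B \<subseteq> J" for J
  proof (rule ccontr)
    assume "J \<noteq> B"
    then obtain x where "x \<in> J - B"
      using \<open>B \<subseteq> J\<close> by (metis Diff_iff set_eq_subset subsetI)
    moreover from this have "insert x B \<in> \<I>"
      using that indep_downward_closed[of J "insert x B"] by auto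
    ultimately show False
      using B by (auto simp: cl_def)
  qed
  then show "matroid_base \<I> B"
    using B by (simp add: matroid_base_def)
qed

section \<open>Replacing parts of bases\<close>

lemma notin_cl_if_indep_Un:
  assumes "U \<union> W \<in> \<I>" "U \<inter> W = {}" "w \<in> W"
  shows "w \<notin> cl \<I> U"
proof -
  have "insert w U \<subseteq> U \<union> W" "w \<notin> U"
    using assms by auto
  then show ?thesis
    using indep_downward_closed[OF assms(1)] by (simp add: cl_def)
qed

text \<open>Elements of \<open>W\<close> are added one at a time. Since \<open>U\<close> spans
  \<open>V\<close>, a new \<open>w\<close> outside the closure of \<open>U \<union> T\<close> is
  also outside the closure of \<open>V \<union> T\<close>. Finitarity passes from finite
  \<open>T\<close> to all of \<open>W\<close>.\<close>

lemma indep_replace: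
  assumes UW: "U \<union> W \<in> \<I>" "U \<inter> W = {}" and V: "V \<in> \<I>" "V \<subseteq> cl \<I> U"
  shows "V \<union> W \<in> \<I>"
proof -
  have fin: "V \<union> T \<in> \<I>" if "finite T" "T \<subseteq> W" for T
    using that
  proof (induction T rule: finite_induct)
    case (insert w T)
    have UT: "U \<union> T \<in> \<I>"
      by (rule indep_downward_closed[OF UW(1)]) (use insert.prems in auto)
    have "V \<union> T \<subseteq> cl \<I> (U \<union> T)"
      using V cl_mono[of U "U \<union> T"] cl_superset[of "U \<union> T" \<I>] by auto
    then have "cl \<I> (V \<union> T) \<subseteq> cl \<I> (U \<union> T)"
      using cl_trans[OF UT] insert by auto
    moreover have "w \<notin> cl \<I> (U \<union> T)"
    proof (rule notin_cl_if_indep_Un)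
      show "(U \<union> T) \<union> (W - T) \<in> \<I>"
        by (rule indep_downward_closed[OF UW(1)]) (use insert.prems in auto)
    qed (use insert UW in auto)
    ultimately have "w \<notin> cl \<I> (V \<union> T)"
      by blast
    then show ?case
      by (simp add: cl_def)
  qed (simp add: V)
  show ?thesis
  proof (rule indep_if_finite_subsets_indep)
    fix Y assume "Y \<subseteq> V \<union> W" "finite Y"
    then show "Y \<in> \<I>"
      using fin[of "Y \<inter> W"] indep_downward_closed[of "V \<union> (Y \<inter> W)" Y] by auto
  qed
qed

lemma base_replace:
  assumes UW: "matroid_base \<I> (U \<union> W)" "U \<inter> W = {}"
    and V: "V \<in> \<I>" "V \<subseteq> cl \<I> U" "U \<subseteq> cl \<I> V"
  shows "matroid_base \<I> (V \<union> W)"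
proof -
  have VW: "V \<union> W \<in> \<I>"
    using UW V indep_replace matroid_base_indep by blast
  have "U \<union> W \<subseteq> cl \<I> (V \<union> W)"
    using V(3) cl_mono[of V "V \<union> W"] cl_superset[of "V \<union> W" \<I>] by auto
  then have "cl \<I> (V \<union> W) = UNIV"
    using cl_trans[OF VW, of "U \<union> W"] UW(1) matroid_base_iff_cl by auto
  then show ?thesis
    using VW matroid_base_iff_cl by blast
qed

text \<open>Maximality of \<open>B\<close> makes \<open>insert f B\<close> dependent, which puts
  \<open>e\<close> back into the closure of the swapped set.\<close>

lemma base_swap:
  assumes B: "matroid_base \<I> B" and e: "e \<in> B" and f: "f \<notin> B" "insert f (B - {e}) \<in> \<I>"
  shows "matroid_base \<I> (insert f (B - {e}))"
proof -
  have "insert f B \<notin> \<I>"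
    using B f by (auto simp: matroid_base_def)
  moreover have "insert e (insert f (B - {e})) = insert f B"
    using e by auto
  ultimately have "B \<subseteq> cl \<I> (insert f (B - {e}))"
    by (auto simp: cl_def)
  then have "cl \<I> (insert f (B - {e})) = UNIV"
    using cl_trans[OF f(2), of B] B matroid_base_iff_cl by auto
  then show ?thesis
    using f matroid_base_iff_cl by blast
qed

text \<open>Let \<open>insert e Z\<close> be the fundamental circuit of \<open>e\<close> over
  \<open>B'\<close>. Every element of \<open>Z\<close> can be traded for \<open>e\<close> in
  \<open>B'\<close>, and some element of \<open>Z\<close> is not spanned by \<open>B - {e}\<close>,
  since otherwise \<open>e\<close> would be. That element is \<open>f\<close>.\<close>

lemma symmetric_exchange:
  assumes B: "matroid_base \<I> B" and B': "matroid_base \<I> B'" and e: "e \<in> B - B'"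
  obtains f where "f \<in> B' - B" "matroid_base \<I> (insert f (B - {e}))"
    "matroid_base \<I> (insert e (B' - {f}))"
proof -
  have BI: "B \<in> \<I>" "B' \<in> \<I>"
    using B B' by (auto simp: matroid_base_def)
  have dep: "insert e B' \<notin> \<I>"
    using B' e by (auto simp: matroid_base_def)
  define S where "S = (\<lambda>Z. Z \<subseteq> B' \<and> finite Z \<and> insert e Z \<notin> \<I>)"
  have "e \<in> cl \<I> B'"
    using dep by (auto simp: cl_def)
  then obtain Z\<^sub>0 where "Z\<^sub>0 \<subseteq> B'" "finite Z\<^sub>0" "e \<in> cl \<I> Z\<^sub>0"
    by (rule cl_finite_support[OF BI(2)])
  then have "S Z\<^sub>0"
    using e by (auto simp: cl_def S_def)
  \<comment> \<open>Least cardinality makes \<open>insert e Z\<close> a circuit: deleting any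
    \<open>z\<close> from \<open>Z\<close> restores independence.\<close>
  then obtain Z where Z: "S Z" and min: "\<And>V. S V \<Longrightarrow> card Z \<le> card V"
    using ex_has_least_nat[of S Z\<^sub>0 card] by blast
  have ZI: "Z \<in> \<I>" "Z \<subseteq> B'" "e \<notin> Z"
    using Z BI e indep_downward_closed by (auto simp: S_def)
  have exch: "insert e (B' - {z}) \<in> \<I>" if z: "z \<in> Z" for z
  proof (rule ccontr)
    assume "insert e (B' - {z}) \<notin> \<I>"
    then have e_cl: "e \<in> cl \<I> (B' - {z})"
      by (simp add: cl_def)
    have "\<not> S (Z - {z})"
      using min[of "Z - {z}"] z Z card_Diff1_less[of Z z] by (auto simp: S_def)
    then have Vi: "insert e (Z - {z}) \<in> \<I>"
      using Z by (auto simp: S_def)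
    have "insert z (insert e (Z - {z})) = insert e Z"
      using z by auto
    then have "z \<in> cl \<I> (insert e (Z - {z}))"
      using Z by (auto simp: cl_def S_def)
    moreover have Bz: "B' - {z} \<in> \<I>"
      using BI indep_downward_closed by blast
    moreover have "insert e (Z - {z}) \<subseteq> cl \<I> (B' - {z})"
      using e_cl ZI cl_superset[of "B' - {z}" \<I>] by auto
    ultimately have "z \<in> cl \<I> (B' - {z})"
      using cl_trans[OF Bz Vi] by blast
    moreover have "insert z (B' - {z}) = B'"
      using z ZI by auto
    ultimately show False
      using BI by (auto simp: cl_def)
  qed
  have Be: "B - {e} \<in> \<I>" "insert e (B - {e}) = B"
    using BI e indep_downward_closed by auto
  have "\<not> Z \<subseteq> cl \<I> (B - {e})"
  proof
    assume "Z \<subseteq> cl \<I> (B - {e})"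
    then have "cl \<I> Z \<subseteq> cl \<I> (B - {e})"
      using cl_trans Be ZI by blast
    moreover have "e \<in> cl \<I> Z"
      using Z by (simp add: cl_def S_def)
    ultimately show False
      using Be BI by (auto simp: cl_def)
  qed
  then obtain f where f: "f \<in> Z" "f \<notin> cl \<I> (B - {e})"
    by blast
  then have fB: "insert f (B - {e}) \<in> \<I>" "f \<notin> B" "f \<in> B'"
    using e ZI by (auto simp: cl_def)
  show ?thesis
    using that[of f] fB base_swap[OF B, of e f] base_swap[OF B', of f e] e exch[OF f(1)] by auto
qed

end

section \<open>Countable bases: back-and-forth exchange\<close>

text \<open>
  Two bases \<open>X \<union> P\<close> and \<open>X \<union> Q\<close> with common part \<open>X\<close>, that is, two bases \<open>P\<close> and \<open>Q\<close>
  of the contraction by \<open>X\<close>.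
\<close>

definition base_pair :: "'a set set \<Rightarrow> 'a set \<Rightarrow> 'a set \<Rightarrow> 'a set \<Rightarrow> bool" where
  "base_pair \<I> X P Q \<longleftrightarrow>
    X \<inter> (P \<union> Q) = {} \<and> matroid_base \<I> (X \<union> P) \<and> matroid_base \<I> (X \<union> Q)"

lemma base_pair_sym: "base_pair \<I> X P Q \<Longrightarrow> base_pair \<I> X Q P"
  by (auto simp: base_pair_def)

definition exchange_step :: "'a set set \<Rightarrow> 'a set \<Rightarrow> 'a set \<Rightarrow> 'a set \<Rightarrow> 'a \<Rightarrow> 'a \<Rightarrow> 'a \<Rightarrow> bool" where
  "exchange_step \<I> X P Q x e f \<longleftrightarrow>
    e \<in> P \<and> f \<in> Q \<and> (x \<in> P \<longrightarrow> e = x) \<and> (x \<in> Q \<longrightarrow> f = x) \<and>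
    base_pair \<I> (insert e X) (P - {e}) (Q - {f}) \<and> base_pair \<I> (insert f X) (P - {e}) (Q - {f})"

lemma exchange_step_sym:
  "exchange_step \<I> X P Q x e f \<Longrightarrow> exchange_step \<I> X Q P x f e"
  by (auto simp: exchange_step_def base_pair_sym)

text \<open>By symmetry let \<open>x \<in> P\<close>. If \<open>x\<close> is also in
  \<open>Q\<close>, it is paired with itself. Otherwise symmetric exchange yields two of the four
  required bases; the other two are the given ones rewritten.\<close>

lemma (in finitary_matroid) exchange_step_exists:
  assumes bp: "base_pair \<I> X P Q" and x: "x \<in> P \<union> Q"
  shows "\<exists>e f. exchange_step \<I> X P Q x e f"
proof -
  have one_sided: "\<exists>e f. exchange_step \<I> X P Q x e f"
    if bp: "base_pair \<I> X P Q" and x: "x \<in> P" for P Q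
  proof (cases "x \<in> Q")
    case True
    have "insert x X \<union> (P - {x}) = X \<union> P" "insert x X \<union> (Q - {x}) = X \<union> Q"
      using x True by auto
    then have "exchange_step \<I> X P Q x x x"
      using bp x True by (auto simp: exchange_step_def base_pair_def)
    then show ?thesis
      by blast
  next
    case False
    have disj: "X \<inter> (P \<union> Q) = {}" and B: "matroid_base \<I> (X \<union> P)" "matroid_base \<I> (X \<union> Q)"
      using bp by (auto simp: base_pair_def)
    have "x \<in> (X \<union> P) - (X \<union> Q)"
      using x False disj by auto
    then obtain f where f: "f \<in> (X \<union> Q) - (X \<union> P)"
      and swap: "matroid_base \<I> (insert f (X \<union> P - {x}))" "matroid_base \<I> (insert x (X \<union> Q - {f}))"
      by (rule symmetric_exchange[OF B])
    have "insert f (X \<union> P - {x}) = insert f X \<union> (P - {x})"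
      "insert x (X \<union> Q - {f}) = insert x X \<union> (Q - {f})"
      "insert x X \<union> (P - {x}) = X \<union> P" "insert f X \<union> (Q - {f}) = X \<union> Q"
      using x f disj by auto
    then have "exchange_step \<I> X P Q x x f"
      using x f False disj B swap by (auto simp: exchange_step_def base_pair_def)
    then show ?thesis
      by blast
  qed
  show ?thesis
    using x
  proof
    assume "x \<in> Q"
    then obtain e f where "exchange_step \<I> X Q P x e f"
      using one_sided[OF base_pair_sym[OF bp]] by blast
    from exchange_step_sym[OF this] show ?thesis
      by blast
  qed (use one_sided[OF bp] in blast)
qed

text \<open>
  \<open>x n\<close> is the element that step \<open>n\<close> must use up, and \<open>p\<close>, \<open>q\<close> choose the pair \<open>(e, f)\<close>
  containing it. In state \<open>(X, P, Q)\<close> the finite sets \<open>I \<subseteq> P\<close> and \<open>J \<subseteq> Q\<close> correspond to each other.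
  The flag \<open>s\<close> is true in the intended reading, where \<open>X\<close> grows towards \<open>X \<union> (P - I) \<union> J\<close>;
  its negation interchanges the two sides, which makes the relation symmetric.
\<close>

inductive exchange_tree ::
  "bool \<Rightarrow> (nat \<Rightarrow> 'a) \<Rightarrow> ('a set \<Rightarrow> 'a set \<Rightarrow> 'a set \<Rightarrow> 'a \<Rightarrow> 'a) \<Rightarrow>
    ('a set \<Rightarrow> 'a set \<Rightarrow> 'a set \<Rightarrow> 'a \<Rightarrow> 'a) \<Rightarrow>
    nat \<Rightarrow> 'a set \<Rightarrow> 'a set \<Rightarrow> 'a set \<Rightarrow> 'a set \<Rightarrow> 'a set \<Rightarrow> bool"
  for s x p q where
  stop: "exchange_tree s x p q n X P Q {} {}"
| skip: "x n \<notin> P \<union> Q \<Longrightarrow> exchange_tree s x p q (Suc n) X P Q I J \<Longrightarrow>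
    exchange_tree s x p q n X P Q I J"
| swap: "x n \<in> P \<union> Q \<Longrightarrow> e = p X P Q (x n) \<Longrightarrow> f = q X P Q (x n) \<Longrightarrow> e \<notin> I \<Longrightarrow> f \<notin> J \<Longrightarrow>
    exchange_tree s x p q (Suc n) (insert (if s then f else e) X) (P - {e}) (Q - {f}) I J \<Longrightarrow>
    exchange_tree s x p q n X P Q (insert e I) (insert f J)"
| keep: "x n \<in> P \<union> Q \<Longrightarrow> e = p X P Q (x n) \<Longrightarrow> f = q X P Q (x n) \<Longrightarrow> e \<notin> I \<Longrightarrow> f \<notin> J \<Longrightarrow>
    exchange_tree s x p q (Suc n) (insert (if s then e else f) X) (P - {e}) (Q - {f}) I J \<Longrightarrow>
    exchange_tree s x p q n X P Q I J"

text \<open>Turns injectivity and surjectivity into functionality and totality of the tree with its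
  sides interchanged.\<close>

lemma exchange_tree_sym:
  assumes "exchange_tree s x p q n X P Q I J"
  shows "exchange_tree (\<not> s) x (\<lambda>X P Q. q X Q P) (\<lambda>X P Q. p X Q P) n X Q P J I"
  using assms
proof (induction rule: exchange_tree.induct)
  case (stop n X P Q)
  show ?case
    by (rule exchange_tree.stop)
next
  case (skip n P Q X I J)
  show ?case
    by (rule exchange_tree.skip[OF _ skip.IH]) (use skip.hyps(1) in blast)
next
  case (swap n P Q e X f I J)
  have "exchange_tree (\<not> s) x (\<lambda>X P Q. q X Q P) (\<lambda>X P Q. p X Q P) (Suc n)
    (insert (if \<not> s then e else f) X) (Q - {f}) (P - {e}) J I"
    using swap.IH by (cases s) simp_all
  then show ?case
    by (rule exchange_tree.swap[rotated -1]) (use swap.hyps(1-5) in \<open>blast+\<close>)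
next
  case (keep n P Q e X f I J)
  have "exchange_tree (\<not> s) x (\<lambda>X P Q. q X Q P) (\<lambda>X P Q. p X Q P) (Suc n)
    (insert (if \<not> s then f else e) X) (Q - {f}) (P - {e}) J I"
    using keep.IH by (cases s) simp_all
  then show ?case
    by (rule exchange_tree.keep[rotated -1]) (use keep.hyps(1-5) in \<open>blast+\<close>)
qed

text \<open>The rule \<open>stop\<close> overlaps with all the others; this keeps the overlap from
  giving the empty set a second partner.\<close>

lemma exchange_tree_empty_iff: "exchange_tree s x p q n X P Q I J \<Longrightarrow> I = {} \<longleftrightarrow> J = {}"
  by (induction rule: exchange_tree.induct) auto

text \<open>The state determines \<open>e\<close> and \<open>f\<close>, and membership of
  \<open>e\<close> in the first set decides between \<open>swap\<close> and \<open>keep\<close>. The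
  premise \<open>e \<notin> I\<close> of both rules makes this work; \<open>f \<notin> J\<close>
  does the same for the mirrored tree.\<close>

lemma exchange_tree_functional:
  assumes "exchange_tree s x p q n X P Q I J" "exchange_tree s x p q n X P Q I J'"
  shows "J = J'"
  using assms
proof (induction arbitrary: J' rule: exchange_tree.induct)
  case (stop n X P Q)
  then show ?case
    using exchange_tree_empty_iff by blast
next
  case (skip n P Q X I J)
  from skip.prems skip.hyps show ?case
    by (cases rule: exchange_tree.cases)
      (use skip.IH exchange_tree_empty_iff in \<open>blast+\<close>)
next
  case (swap n P Q e X f I J)
  from swap.prems show ?case
  proof (cases rule: exchange_tree.cases)
    case stop
    then show ?thesis
      by simp
  next
    case skip
    then show ?thesis
      using swap.hyps(1) by simp
  next
    case (swap e' f' I' K)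
    have eq: "e' = e" "f' = f"
      using swap.hyps(2,3) swap by simp_all
    then have "I' = I"
      using swap.hyps(4) swap by (metis insert_ident)
    then have "J = K"
      using swap.IH swap(8)[unfolded eq \<open>I' = I\<close>] by blast
    then show ?thesis
      using swap eq by simp
  next
    case (keep e' f')
    then show ?thesis
      using swap.hyps(2) by simp
  qed
next
  case (keep n P Q e X f I J)
  from keep.prems show ?case
  proof (cases rule: exchange_tree.cases)
    case stop
    then show ?thesis
      using exchange_tree_empty_iff[OF keep.hyps(6)] by simp
  next
    case skip
    then show ?thesis
      using keep.hyps(1) by simp
  next
    case (swap e' f' I' K)
    then show ?thesis
      using keep.hyps(2,4) by simp
  next
    case (keep e' f')
    have eq: "e' = e" "f' = f"
      using keep.hyps(2,3) keep by simp_all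
    then show ?thesis
      using keep.IH keep(6)[unfolded eq] by blast
  qed
qed

lemma exchange_tree_injective:
  assumes "exchange_tree s x p q n X P Q I J" "exchange_tree s x p q n X P Q I' J"
  shows "I = I'"
  using exchange_tree_functional[OF exchange_tree_sym[OF assms(1)] exchange_tree_sym[OF assms(2)]] .

section \<open>Invariants and totality of the exchange tree\<close>

definition step_choice ::
  "'a set set \<Rightarrow> ('a set \<Rightarrow> 'a set \<Rightarrow> 'a set \<Rightarrow> 'a \<Rightarrow> 'a) \<Rightarrow>
    ('a set \<Rightarrow> 'a set \<Rightarrow> 'a set \<Rightarrow> 'a \<Rightarrow> 'a) \<Rightarrow> bool" where
  "step_choice \<I> p q \<longleftrightarrow> (\<forall>X P Q x. base_pair \<I> X P Q \<longrightarrow> x \<in> P \<union> Q \<longrightarrow>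
    exchange_step \<I> X P Q x (p X P Q x) (q X P Q x))"

lemma step_choiceD:
  "step_choice \<I> p q \<Longrightarrow> base_pair \<I> X P Q \<Longrightarrow> x \<in> P \<union> Q \<Longrightarrow>
    exchange_step \<I> X P Q x (p X P Q x) (q X P Q x)"
  by (simp only: step_choice_def)

lemma step_choice_sym:
  assumes "step_choice \<I> p q"
  shows "step_choice \<I> (\<lambda>X P Q. q X Q P) (\<lambda>X P Q. p X Q P)"
  unfolding step_choice_def
proof (intro allI impI)
  fix X P Q x assume "base_pair \<I> X P Q" "x \<in> P \<union> Q"
  then show "exchange_step \<I> X P Q x (q X Q P x) (p X Q P x)"
    using exchange_step_sym[OF step_choiceD[OF assms base_pair_sym]] by blast
qed

lemma exchange_tree_Fpow:
  assumes "step_choice \<I> p q" "exchange_tree s x p q n X P Q I J" "base_pair \<I> X P Q"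
  shows "I \<in> Fpow P \<and> J \<in> Fpow Q"
  using assms(2,3)
proof (induction rule: exchange_tree.induct)
  case (swap n P Q e X f I J)
  then have "exchange_step \<I> X P Q (x n) e f"
    using step_choiceD[OF assms(1)] by blast
  then have "e \<in> P" "f \<in> Q" "base_pair \<I> (insert (if s then f else e) X) (P - {e}) (Q - {f})"
    by (auto simp: exchange_step_def)
  then show ?case
    using swap.IH by (auto simp: Fpow_def)
next
  case (keep n P Q e X f I J)
  then have "exchange_step \<I> X P Q (x n) e f"
    using step_choiceD[OF assms(1)] by blast
  then have "base_pair \<I> (insert (if s then e else f) X) (P - {e}) (Q - {f})"
    by (auto simp: exchange_step_def)
  then show ?case
    using keep.IH by (auto simp: Fpow_def)
qed (auto simp: Fpow_def)

text \<open>Each step moves into \<open>X\<close> the element that belongs to the target set,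
  \<open>f\<close> when swapping and \<open>e\<close> when keeping, so the target set stays the same
  along a derivation.\<close>

lemma exchange_tree_base:
  assumes "step_choice \<I> p q" "exchange_tree True x p q n X P Q I J" "base_pair \<I> X P Q"
  shows "matroid_base \<I> (X \<union> (P - I) \<union> J)"
  using assms(2,3)
proof (induction rule: exchange_tree.induct)
  case (stop n X P Q)
  then show ?case
    by (simp add: base_pair_def)
next
  case (skip n P Q X I J)
  then show ?case
    by simp
next
  case (swap n P Q e X f I J)
  then have "exchange_step \<I> X P Q (x n) e f"
    using step_choiceD[OF assms(1)] by blast
  then have "base_pair \<I> (insert f X) (P - {e}) (Q - {f})"
    by (auto simp: exchange_step_def)
  moreover have "insert f X \<union> (P - {e} - I) \<union> J = X \<union> (P - insert e I) \<union> insert f J"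
    by auto
  ultimately show ?case
    using swap.IH by simp
next
  case (keep n P Q e X f I J)
  then have "exchange_step \<I> X P Q (x n) e f"
    using step_choiceD[OF assms(1)] by blast
  then have "e \<in> P" "base_pair \<I> (insert e X) (P - {e}) (Q - {f})"
    by (auto simp: exchange_step_def)
  moreover from this have "insert e X \<union> (P - {e} - I) \<union> J = X \<union> (P - I) \<union> J"
    using keep.hyps by auto
  ultimately show ?case
    using keep.IH by simp
qed

text \<open>If \<open>x n \<in> P\<close> then \<open>e = x n\<close>, so after one step the rest of
  \<open>I\<close> is covered by the next \<open>k\<close> values; once nothing is left,
  \<open>stop\<close> applies. The flag is arbitrary, so the mirrored tree is included.\<close>

lemma exchange_tree_total:
  assumes choice: "step_choice \<I> p q"
  shows "base_pair \<I> X P Q \<Longrightarrow> I \<subseteq> P \<Longrightarrow> I \<subseteq> x ` {n..<n + k} \<Longrightarrow>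
    \<exists>J. exchange_tree s x p q n X P Q I J"
proof (induction k arbitrary: n X P Q I)
  case 0
  then show ?case
    using exchange_tree.stop by force
next
  case (Suc k)
  have I: "I \<subseteq> insert (x n) (x ` {Suc n..<Suc n + k})"
  proof
    fix i assume "i \<in> I"
    then obtain m where "i = x m" "n \<le> m" "m < n + Suc k"
      using Suc.prems(3) by auto
    then show "i \<in> insert (x n) (x ` {Suc n..<Suc n + k})"
      by (cases "m = n") auto
  qed
  show ?case
  proof (cases "x n \<in> P \<union> Q")
    case False
    then have "I \<subseteq> x ` {Suc n..<Suc n + k}"
      using I Suc.prems(2) by auto
    then show ?thesis
      using Suc.IH[OF Suc.prems(1,2)] exchange_tree.skip False by metis
  next
    case True
    define e f where ef: "e = p X P Q (x n)" "f = q X P Q (x n)"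
    have "exchange_step \<I> X P Q (x n) e f"
      unfolding ef by (rule step_choiceD[OF choice Suc.prems(1) True])
    then have step: "x n \<in> P \<Longrightarrow> e = x n"
      and bp: "base_pair \<I> (insert (if s then e else f) X) (P - {e}) (Q - {f})"
        "base_pair \<I> (insert (if s then f else e) X) (P - {e}) (Q - {f})"
      by (auto simp: exchange_step_def)
    have sub: "I - {e} \<subseteq> P - {e}" "I - {e} \<subseteq> x ` {Suc n..<Suc n + k}"
      using I Suc.prems(2) step by auto
    show ?thesis
    proof (cases "e \<in> I")
      case eI: True
      obtain J where J: "exchange_tree s x p q (Suc n) (insert (if s then f else e) X) (P - {e})
          (Q - {f}) (I - {e}) J"
        using Suc.IH[OF bp(2) sub] by blast
      moreover have "f \<notin> J"
        using exchange_tree_Fpow[OF choice J bp(2)] by (auto simp: Fpow_def)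
      ultimately have "exchange_tree s x p q n X P Q (insert e (I - {e})) (insert f J)"
        using exchange_tree.swap[where p = p and q = q and x = x and n = n, OF True ef] by blast
      then show ?thesis
        using eI by (auto simp: insert_absorb)
    next
      case eI: False
      obtain J where J: "exchange_tree s x p q (Suc n) (insert (if s then e else f) X) (P - {e})
          (Q - {f}) (I - {e}) J"
        using Suc.IH[OF bp(1) sub] by blast
      moreover have "f \<notin> J"
        using exchange_tree_Fpow[OF choice J bp(1)] by (auto simp: Fpow_def)
      ultimately show ?thesis
        using exchange_tree.keep[where p = p and q = q and x = x and n = n, OF True ef] eI by auto
    qed
  qed
qed

text \<open>A relation rather than a function, so that partial bijections are ordered by inclusion
  and chains of them have unions.\<close>

definition bijection_rel :: "'a set \<Rightarrow> 'b set \<Rightarrow> ('a \<times> 'b) set \<Rightarrow> bool" where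
  "bijection_rel A B R \<longleftrightarrow>
    R \<subseteq> A \<times> B \<and> (\<forall>a\<in>A. \<exists>!b. (a, b) \<in> R) \<and> (\<forall>b\<in>B. \<exists>!a. (a, b) \<in> R)"

lemma bijection_relI:
  assumes "\<And>a b. (a, b) \<in> R \<Longrightarrow> a \<in> A \<and> b \<in> B"
    and "\<And>a. a \<in> A \<Longrightarrow> \<exists>b. (a, b) \<in> R"
    and "\<And>b. b \<in> B \<Longrightarrow> \<exists>a. (a, b) \<in> R"
    and "\<And>a b b'. (a, b) \<in> R \<Longrightarrow> (a, b') \<in> R \<Longrightarrow> b = b'"
    and "\<And>a b a'. (a, b) \<in> R \<Longrightarrow> (a', b) \<in> R \<Longrightarrow> a = a'"
  shows "bijection_rel A B R"
  unfolding bijection_rel_def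
proof (intro conjI ballI subrelI)
  show "\<exists>!b. (a, b) \<in> R" if "a \<in> A" for a
    using assms(2)[OF that] assms(4) by (auto intro: ex_ex1I)
  show "\<exists>!a. (a, b) \<in> R" if "b \<in> B" for b
    using assms(3)[OF that] assms(5) by (auto intro: ex_ex1I)
qed (use assms(1) in auto)

lemma bijection_rel_mem: "bijection_rel A B R \<Longrightarrow> (a, b) \<in> R \<Longrightarrow> a \<in> A \<and> b \<in> B"
  by (auto simp: bijection_rel_def)

lemma bijection_rel_total: "bijection_rel A B R \<Longrightarrow> a \<in> A \<Longrightarrow> \<exists>b. (a, b) \<in> R"
  unfolding bijection_rel_def by blast

lemma bijection_rel_surjective: "bijection_rel A B R \<Longrightarrow> b \<in> B \<Longrightarrow> \<exists>a. (a, b) \<in> R"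
  unfolding bijection_rel_def by blast

lemma bijection_rel_functional:
  "bijection_rel A B R \<Longrightarrow> (a, b) \<in> R \<Longrightarrow> (a, b') \<in> R \<Longrightarrow> b = b'"
  unfolding bijection_rel_def by blast

lemma bijection_rel_injective:
  "bijection_rel A B R \<Longrightarrow> (a, b) \<in> R \<Longrightarrow> (a', b) \<in> R \<Longrightarrow> a = a'"
  unfolding bijection_rel_def by blast

lemma bijection_rel_imp_bij_betw:
  assumes R: "bijection_rel A B R"
  obtains F where "bij_betw F A B" "\<And>a. a \<in> A \<Longrightarrow> (a, F a) \<in> R"
proof -
  obtain F where F: "\<And>a. a \<in> A \<Longrightarrow> (a, F a) \<in> R"
    using bijection_rel_total[OF R] by metis
  have "inj_on F A"
    using F bijection_rel_injective[OF R] by (metis inj_onI)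
  moreover have "F ` A \<subseteq> B"
    using F bijection_rel_mem[OF R] by blast
  moreover have "b \<in> F ` A" if b: "b \<in> B" for b
  proof -
    obtain a where "(a, b) \<in> R"
      using bijection_rel_surjective[OF R b] by blast
    then have "a \<in> A" "b = F a"
      using bijection_rel_mem[OF R] F bijection_rel_functional[OF R] by blast+
    then show ?thesis
      by blast
  qed
  ultimately show ?thesis
    using that[of F] F by (auto simp: bij_betw_def)
qed

text \<open>The form \<open>{0..<0 + k}\<close> matches \<open>exchange_tree_total\<close> at
  \<open>n = 0\<close>.\<close>

lemma finite_subset_initial_image:
  fixes x :: "nat \<Rightarrow> 'a"
  assumes "finite I" "I \<subseteq> range x"
  obtains k where "I \<subseteq> x ` {0..<0 + k}"
proof -
  obtain N where N: "finite N" "I = x ` N"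
    using assms finite_subset_image[of I x UNIV] by auto
  obtain k where "\<forall>n\<in>N. n < k"
    using N(1) finite_nat_set_iff_bounded by blast
  then show ?thesis
    using that[of k] N by fastforce
qed

text \<open>The tree is run along one enumeration of both sides, so every finite set on either side
  is reached after finitely many steps. The pair \<open>({}, {})\<close> is recorded so that a glued
  relation contains the one it extends.\<close>

lemma (in finitary_matroid) countable_base_exchange:
  assumes bp: "base_pair \<I> X P Q" and count: "countable P" "countable Q"
  shows "\<exists>R. bijection_rel (Fpow P) (Fpow Q) R \<and>
    (\<forall>(I, J) \<in> R. matroid_base \<I> (X \<union> (P - I) \<union> J)) \<and> ({}, {}) \<in> R"
proof -
  define p where "p X P Q x = (SOME e. \<exists>f. exchange_step \<I> X P Q x e f)" for X P Q x
  define q where "q X P Q x = (SOME f. exchange_step \<I> X P Q x (p X P Q x) f)" for X P Q x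
  have choice: "step_choice \<I> p q"
    unfolding step_choice_def
  proof (intro allI impI)
    fix X P Q x assume "base_pair \<I> X P Q" "x \<in> P \<union> Q"
    then have "\<exists>f. exchange_step \<I> X P Q x (p X P Q x) f"
      unfolding p_def using someI_ex[OF exchange_step_exists] by blast
    then show "exchange_step \<I> X P Q x (p X P Q x) (q X P Q x)"
      unfolding q_def by (rule someI_ex)
  qed
  \<comment> \<open>An inclusion suffices: \<open>skip\<close> passes over values that are repeated
    or already used up as partners.\<close>
  obtain x :: "nat \<Rightarrow> 'a" where x: "P \<union> Q \<subseteq> range x"
    using range_from_nat_into_subset subset_range_from_nat_into[of "P \<union> Q"] count by blast
  define R where "R = {(I, J). exchange_tree True x p q 0 X P Q I J}"
  have total: "\<exists>J. (I, J) \<in> R" if "I \<in> Fpow P" for I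
  proof -
    have "finite I" "I \<subseteq> range x" "I \<subseteq> P"
      using that x by (auto simp: Fpow_def)
    then obtain k where "I \<subseteq> x ` {0..<0 + k}"
      using finite_subset_initial_image by blast
    then show ?thesis
      using exchange_tree_total[OF choice bp \<open>I \<subseteq> P\<close>] by (auto simp: R_def)
  qed
  have surj: "\<exists>I. (I, J) \<in> R" if "J \<in> Fpow Q" for J
  proof -
    have "finite J" "J \<subseteq> range x" "J \<subseteq> Q"
      using that x by (auto simp: Fpow_def)
    then obtain k where "J \<subseteq> x ` {0..<0 + k}"
      using finite_subset_initial_image by blast
    \<comment> \<open>Totality is applied to the mirrored tree, with flag \<open>False\<close> and
      the sides interchanged.\<close>
    then obtain I where
      "exchange_tree False x (\<lambda>X P Q. q X Q P) (\<lambda>X P Q. p X Q P) 0 X Q P J I"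
      using exchange_tree_total[OF step_choice_sym[OF choice] base_pair_sym[OF bp] \<open>J \<subseteq> Q\<close>]
      by blast
    then show ?thesis
      using exchange_tree_sym by (fastforce simp: R_def)
  qed
  have func: "J = J'" if "(I, J) \<in> R" "(I, J') \<in> R" for I J J'
    using that exchange_tree_functional unfolding R_def by blast
  have inj: "I = I'" if "(I, J) \<in> R" "(I', J) \<in> R" for I I' J
    using that exchange_tree_injective unfolding R_def by blast
  have R_base: "I \<in> Fpow P \<and> J \<in> Fpow Q \<and> matroid_base \<I> (X \<union> (P - I) \<union> J)"
    if "(I, J) \<in> R" for I J
    using that exchange_tree_base[OF choice _ bp] exchange_tree_Fpow[OF choice _ bp]
    by (simp add: R_def)
  have "bijection_rel (Fpow P) (Fpow Q) R"
  proof (rule bijection_relI)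
    show "I \<in> Fpow P \<and> J \<in> Fpow Q" if "(I, J) \<in> R" for I J
      using R_base[OF that] by simp
  qed (use total in blast, use surj in blast, use func in blast, use inj in blast)
  moreover have "({}, {}) \<in> R"
    by (simp add: R_def exchange_tree.stop)
  ultimately show ?thesis
    using R_base by blast
qed

section \<open>Gluing countable pieces\<close>

text \<open>Disjointness makes the splitting of a finite set into its two parts unique on each
  side.\<close>

lemma bijection_rel_Fpow_Un:
  assumes R: "bijection_rel (Fpow A) (Fpow B) R" and S: "bijection_rel (Fpow A') (Fpow B') S"
    and disj: "A \<inter> A' = {}" "B \<inter> B' = {}"
  shows "bijection_rel (Fpow (A \<union> A')) (Fpow (B \<union> B'))
    {(I \<union> K, J \<union> L) | I J K L. (I, J) \<in> R \<and> (K, L) \<in> S}" (is "bijection_rel _ _ ?T")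
proof (rule bijection_relI)
  have split: "I = I' \<and> K = K'"
    if "I \<union> K = I' \<union> K'" "I \<in> Fpow C" "I' \<in> Fpow C" "K \<in> Fpow D" "K' \<in> Fpow D" "C \<inter> D = {}"
    for I I' K K' C D :: "'c set"
    using that unfolding Fpow_def by blast
  note R_sub = bijection_rel_mem[OF R] and S_sub = bijection_rel_mem[OF S]
  fix M N
  show "M \<in> Fpow (A \<union> A') \<and> N \<in> Fpow (B \<union> B')" if MN: "(M, N) \<in> ?T"
  proof -
    obtain I J K L where "M = I \<union> K" "N = J \<union> L" "(I, J) \<in> R" "(K, L) \<in> S"
      using MN by blast
    then show ?thesis
      using R_sub[of I J] S_sub[of K L] by (auto simp: Fpow_def)
  qed
  show "\<exists>N. (M, N) \<in> ?T" if "M \<in> Fpow (A \<union> A')"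
  proof -
    have M: "M \<inter> A \<in> Fpow A" "M \<inter> A' \<in> Fpow A'" "M = (M \<inter> A) \<union> (M \<inter> A')"
      using that by (auto simp: Fpow_def)
    obtain J L where "(M \<inter> A, J) \<in> R" "(M \<inter> A', L) \<in> S"
      using bijection_rel_total[OF R M(1)] bijection_rel_total[OF S M(2)] by blast
    then show ?thesis
      using M(3) by blast
  qed
  show "\<exists>M. (M, N) \<in> ?T" if "N \<in> Fpow (B \<union> B')"
  proof -
    have N: "N \<inter> B \<in> Fpow B" "N \<inter> B' \<in> Fpow B'" "N = (N \<inter> B) \<union> (N \<inter> B')"
      using that by (auto simp: Fpow_def)
    obtain I K where "(I, N \<inter> B) \<in> R" "(K, N \<inter> B') \<in> S"
      using bijection_rel_surjective[OF R N(1)] bijection_rel_surjective[OF S N(2)] by blast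
    then show ?thesis
      using N(3) by blast
  qed
  show "N = N'" if MN: "(M, N) \<in> ?T" "(M, N') \<in> ?T" for N'
  proof -
    obtain I J K L where 1: "M = I \<union> K" "N = J \<union> L" "(I, J) \<in> R" "(K, L) \<in> S"
      using MN by blast
    obtain I' J' K' L' where 2: "M = I' \<union> K'" "N' = J' \<union> L'" "(I', J') \<in> R" "(K', L') \<in> S"
      using MN by blast
    have "I = I' \<and> K = K'"
      using split[of I K I' K' A A'] 1 2 R_sub S_sub disj by blast
    then show ?thesis
      using 1 2 bijection_rel_functional[OF R] bijection_rel_functional[OF S] by metis
  qed
  show "M = M'" if MN: "(M, N) \<in> ?T" "(M', N) \<in> ?T" for M'
  proof -
    obtain I J K L where 1: "M = I \<union> K" "N = J \<union> L" "(I, J) \<in> R" "(K, L) \<in> S"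
      using MN by blast
    obtain I' J' K' L' where 2: "M' = I' \<union> K'" "N = J' \<union> L'" "(I', J') \<in> R" "(K', L') \<in> S"
      using MN by blast
    have "J = J' \<and> L = L'"
      using split[of J L J' L' B B'] 1 2 R_sub S_sub disj by blast
    then show ?thesis
      using 1 2 bijection_rel_injective[OF R] bijection_rel_injective[OF S] by metis
  qed
qed

lemma countable_closed_superset:
  fixes s :: "'a \<Rightarrow> 'a set"
  assumes "\<And>x. countable (s x)"
  obtains K where "countable K" "e \<in> K" "\<And>x. x \<in> K \<Longrightarrow> s x \<subseteq> K"
proof -
  define step where "step T = (\<Union>x\<in>T. s x)" for T
  define K where "K = (\<Union>n. (step ^^ n) {e})"
  have "countable ((step ^^ n) {e})" for n
    by (induction n) (auto simp: step_def assms)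
  then have "countable K"
    by (simp add: K_def)
  moreover have "e \<in> K"
    unfolding K_def by (rule UN_I[of 0]) auto
  moreover have "s x \<subseteq> K" if x: "x \<in> K" for x
  proof -
    obtain n where "x \<in> (step ^^ n) {e}"
      using x by (auto simp: K_def)
    then have "s x \<subseteq> (step ^^ Suc n) {e}"
      by (auto simp: step_def)
    then show ?thesis
      unfolding K_def by blast
  qed
  ultimately show ?thesis
    using that by blast
qed

text \<open>The two closure inclusions say that the pieces have the same span, so either can stand
  in for the other in a base. Bases are those of the whole matroid, with
  \<open>B\<^sub>0 - A\<^sub>0\<close> left fixed.\<close>

definition partial_exchange ::
  "'a set set \<Rightarrow> 'a set \<Rightarrow> 'a set \<Rightarrow> 'a set \<Rightarrow> 'a set \<Rightarrow> ('a set \<times> 'a set) set \<Rightarrow> bool" where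
  "partial_exchange \<I> B\<^sub>0 B\<^sub>1 A\<^sub>0 A\<^sub>1 R \<longleftrightarrow>
    A\<^sub>0 \<subseteq> B\<^sub>0 \<and> A\<^sub>1 \<subseteq> B\<^sub>1 \<and> A\<^sub>0 \<subseteq> cl \<I> A\<^sub>1 \<and> A\<^sub>1 \<subseteq> cl \<I> A\<^sub>0 \<and>
    bijection_rel (Fpow A\<^sub>0) (Fpow A\<^sub>1) R \<and>
    (\<forall>(I, J) \<in> R. matroid_base \<I> ((B\<^sub>0 - I) \<union> J))"

lemma partial_exchange_empty:
  assumes "matroid_base \<I> B\<^sub>0"
  shows "partial_exchange \<I> B\<^sub>0 B\<^sub>1 {} {} {({}, {})}"
  using assms by (auto simp: partial_exchange_def bijection_rel_def Fpow_def)

section \<open>Extending partial exchanges and Zorn's lemma\<close>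

context finitary_matroid
begin

text \<open>Each element has a finite support in either base; closing \<open>{e}\<close> under both
  supports stays countable.\<close>

lemma countable_span_closed_pieces:
  assumes B: "matroid_base \<I> B\<^sub>0" "matroid_base \<I> B\<^sub>1"
  obtains K where "countable K" "e \<in> K" "K \<subseteq> cl \<I> (K \<inter> B\<^sub>0)" "K \<subseteq> cl \<I> (K \<inter> B\<^sub>1)"
proof -
  have "\<exists>Z\<subseteq>B. finite Z \<and> x \<in> cl \<I> Z" if "matroid_base \<I> B" for B x
    using cl_finite_support[of B x] that by (metis UNIV_I matroid_base_iff_cl)
  then obtain s\<^sub>0 s\<^sub>1 where s\<^sub>0: "\<And>x. s\<^sub>0 x \<subseteq> B\<^sub>0 \<and> finite (s\<^sub>0 x) \<and> x \<in> cl \<I> (s\<^sub>0 x)"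
    and s\<^sub>1: "\<And>x. s\<^sub>1 x \<subseteq> B\<^sub>1 \<and> finite (s\<^sub>1 x) \<and> x \<in> cl \<I> (s\<^sub>1 x)"
    using B by metis
  have "countable (s\<^sub>0 x \<union> s\<^sub>1 x)" for x
    using s\<^sub>0 s\<^sub>1 by (simp add: countable_finite)
  then obtain K where K: "countable K" "e \<in> K" "\<And>x. x \<in> K \<Longrightarrow> s\<^sub>0 x \<union> s\<^sub>1 x \<subseteq> K"
    using countable_closed_superset[of "\<lambda>x. s\<^sub>0 x \<union> s\<^sub>1 x" e] by blast
  have "K \<subseteq> cl \<I> (K \<inter> B\<^sub>0)"
  proof
    fix x assume "x \<in> K"
    then have "s\<^sub>0 x \<subseteq> K \<inter> B\<^sub>0"
      using s\<^sub>0 K(3) by blast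
    then show "x \<in> cl \<I> (K \<inter> B\<^sub>0)"
      using s\<^sub>0 cl_mono by blast
  qed
  moreover have "K \<subseteq> cl \<I> (K \<inter> B\<^sub>1)"
  proof
    fix x assume "x \<in> K"
    then have "s\<^sub>1 x \<subseteq> K \<inter> B\<^sub>1"
      using s\<^sub>1 K(3) by blast
    then show "x \<in> cl \<I> (K \<inter> B\<^sub>1)"
      using s\<^sub>1 cl_mono by blast
  qed
  ultimately show ?thesis
    using that K by blast
qed

text \<open>If \<open>(A\<^sub>0 - I) \<union> J\<close> failed to span some \<open>x\<close> in
  \<open>A\<^sub>0\<close>, adding \<open>x\<close> would keep it independent and inside the closure
  of \<open>A\<^sub>0\<close>. Putting the result in place of \<open>A\<^sub>0\<close> within
  \<open>B\<^sub>0\<close> would give an independent set properly containing the base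
  \<open>(B\<^sub>0 - I) \<union> J\<close>.\<close>

lemma partial_exchange_spans:
  assumes B: "matroid_base \<I> B\<^sub>0" and pe: "partial_exchange \<I> B\<^sub>0 B\<^sub>1 A\<^sub>0 A\<^sub>1 R" and IJ: "(I, J) \<in> R"
  shows "(A\<^sub>0 - I) \<union> J \<in> \<I>" "(A\<^sub>0 - I) \<union> J \<subseteq> cl \<I> A\<^sub>0" "A\<^sub>0 \<subseteq> cl \<I> ((A\<^sub>0 - I) \<union> J)"
proof -
  have base: "matroid_base \<I> ((B\<^sub>0 - I) \<union> J)" and A: "A\<^sub>0 \<subseteq> B\<^sub>0" "A\<^sub>1 \<subseteq> cl \<I> A\<^sub>0"
    and bij: "bijection_rel (Fpow A\<^sub>0) (Fpow A\<^sub>1) R"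
    using pe IJ by (auto simp: partial_exchange_def)
  have sub: "I \<subseteq> A\<^sub>0" "J \<subseteq> A\<^sub>1"
    using bijection_rel_mem[OF bij IJ] by (auto simp: Fpow_def)
  show 1: "(A\<^sub>0 - I) \<union> J \<in> \<I>"
    by (rule indep_downward_closed[OF matroid_base_indep[OF base]]) (use A in auto)
  show 2: "(A\<^sub>0 - I) \<union> J \<subseteq> cl \<I> A\<^sub>0"
    using A sub cl_superset[of A\<^sub>0 \<I>] by auto
  show "A\<^sub>0 \<subseteq> cl \<I> ((A\<^sub>0 - I) \<union> J)"
  proof (rule subsetI, rule ccontr)
    fix x assume x: "x \<in> A\<^sub>0" "x \<notin> cl \<I> ((A\<^sub>0 - I) \<union> J)"
    then have x': "x \<notin> (A\<^sub>0 - I) \<union> J" "insert x ((A\<^sub>0 - I) \<union> J) \<in> \<I>"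
      by (auto simp: cl_def)
    have "insert x ((A\<^sub>0 - I) \<union> J) \<union> (B\<^sub>0 - A\<^sub>0) \<in> \<I>"
    proof (rule indep_replace)
      have "A\<^sub>0 \<union> (B\<^sub>0 - A\<^sub>0) = B\<^sub>0"
        using A by auto
      then show "A\<^sub>0 \<union> (B\<^sub>0 - A\<^sub>0) \<in> \<I>"
        using B by (simp add: matroid_base_indep)
      show "insert x ((A\<^sub>0 - I) \<union> J) \<subseteq> cl \<I> A\<^sub>0"
        using 2 x cl_superset[of A\<^sub>0 \<I>] by auto
    qed (use x' in auto)
    moreover have "insert x ((A\<^sub>0 - I) \<union> J) \<union> (B\<^sub>0 - A\<^sub>0) = insert x ((B\<^sub>0 - I) \<union> J)"
      using A sub by auto
    ultimately have "insert x ((B\<^sub>0 - I) \<union> J) \<in> \<I>"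
      by metis
    then have "insert x ((B\<^sub>0 - I) \<union> J) = (B\<^sub>0 - I) \<union> J"
      using base unfolding matroid_base_def by blast
    then have "x \<in> (B\<^sub>0 - I) \<union> J"
      by blast
    then show False
      using x x' by auto
  qed
qed

text \<open>A countable set around \<open>e\<close> supplies new pieces \<open>D\<^sub>0\<close> and
  \<open>D\<^sub>1\<close>. Both are bases after contracting \<open>A\<^sub>0 \<union> W\<close>, so
  \<open>countable_base_exchange\<close> applies, and its relation is joined to \<open>R\<close> by
  unions.\<close>

lemma partial_exchange_extend:
  assumes B: "matroid_base \<I> B\<^sub>0" "matroid_base \<I> B\<^sub>1"
    and pe: "partial_exchange \<I> B\<^sub>0 B\<^sub>1 A\<^sub>0 A\<^sub>1 R" and e: "e \<in> B\<^sub>0 - A\<^sub>0"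
  shows "\<exists>A\<^sub>0' A\<^sub>1' R'. partial_exchange \<I> B\<^sub>0 B\<^sub>1 A\<^sub>0' A\<^sub>1' R' \<and> R \<subset> R'"
proof -
  obtain K where K: "countable K" "e \<in> K" "K \<subseteq> cl \<I> (K \<inter> B\<^sub>0)" "K \<subseteq> cl \<I> (K \<inter> B\<^sub>1)"
    using countable_span_closed_pieces[OF B] by blast
  define D\<^sub>0 D\<^sub>1 W where D: "D\<^sub>0 = K \<inter> B\<^sub>0 - A\<^sub>0" "D\<^sub>1 = K \<inter> B\<^sub>1 - A\<^sub>1" and W: "W = B\<^sub>0 - A\<^sub>0 - D\<^sub>0"
  have A: "A\<^sub>0 \<subseteq> B\<^sub>0" "A\<^sub>1 \<subseteq> B\<^sub>1" "A\<^sub>0 \<subseteq> cl \<I> A\<^sub>1" "A\<^sub>1 \<subseteq> cl \<I> A\<^sub>0"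
    and bij: "bijection_rel (Fpow A\<^sub>0) (Fpow A\<^sub>1) R"
    using pe by (auto simp: partial_exchange_def)
  have indep: "A\<^sub>0 \<in> \<I>" "A\<^sub>1 \<in> \<I>" "A\<^sub>1 \<union> D\<^sub>1 \<in> \<I>"
    using indep_downward_closed[OF matroid_base_indep[OF B(1)] A(1)]
      indep_downward_closed[OF matroid_base_indep[OF B(2)] A(2)]
      indep_downward_closed[OF matroid_base_indep[OF B(2)], of "A\<^sub>1 \<union> D\<^sub>1"] A D by auto
  have cl_mono': "cl \<I> A\<^sub>0 \<subseteq> cl \<I> (A\<^sub>0 \<union> D\<^sub>0)" "cl \<I> A\<^sub>1 \<subseteq> cl \<I> (A\<^sub>1 \<union> D\<^sub>1)"
    "cl \<I> (K \<inter> B\<^sub>0) \<subseteq> cl \<I> (A\<^sub>0 \<union> D\<^sub>0)" "cl \<I> (K \<inter> B\<^sub>1) \<subseteq> cl \<I> (A\<^sub>1 \<union> D\<^sub>1)"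
    by (rule cl_mono; use D in auto)+
  have "D\<^sub>0 \<subseteq> K" "D\<^sub>1 \<subseteq> K"
    using D by auto
  then have spans: "A\<^sub>0 \<union> D\<^sub>0 \<subseteq> cl \<I> (A\<^sub>1 \<union> D\<^sub>1)" "A\<^sub>1 \<union> D\<^sub>1 \<subseteq> cl \<I> (A\<^sub>0 \<union> D\<^sub>0)"
    using A K cl_mono' by blast+
  have B0_eq: "B\<^sub>0 = A\<^sub>0 \<union> D\<^sub>0 \<union> W" "(A\<^sub>0 \<union> D\<^sub>0) \<inter> W = {}" "A\<^sub>0 \<inter> D\<^sub>0 = {}" "A\<^sub>0 \<inter> W = {}"
    "D\<^sub>0 \<inter> W = {}"
    using A D W by auto
  \<comment> \<open>Inside \<open>B\<^sub>0\<close>, the set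
    \<open>A\<^sub>0 \<union> D\<^sub>0\<close> gives way to
    \<open>A\<^sub>1 \<union> D\<^sub>1\<close>, which has the same span.\<close>
  have base_W: "matroid_base \<I> (A\<^sub>1 \<union> D\<^sub>1 \<union> W)"
    by (rule base_replace[of "A\<^sub>0 \<union> D\<^sub>0"]) (use B0_eq B(1) indep spans in auto)
  have "w \<notin> cl \<I> (A\<^sub>0 \<union> D\<^sub>0)" if "w \<in> W" for w
    by (rule notin_cl_if_indep_Un[where W = W])
      (use B0_eq B(1) that matroid_base_indep in auto)
  then have disj_W: "(A\<^sub>1 \<union> D\<^sub>1) \<inter> W = {}"
    using spans by blast
  have disj_D1: "A\<^sub>1 \<inter> D\<^sub>1 = {}"
    using D by auto
  \<comment> \<open>A second replacement puts \<open>A\<^sub>0\<close> back for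
    \<open>A\<^sub>1\<close>, so that only \<open>D\<^sub>0\<close> has been exchanged.\<close>
  have "matroid_base \<I> (A\<^sub>0 \<union> (D\<^sub>1 \<union> W))"
  proof (rule base_replace)
    show "matroid_base \<I> (A\<^sub>1 \<union> (D\<^sub>1 \<union> W))"
      using base_W by (simp add: Un_assoc)
    show "A\<^sub>1 \<inter> (D\<^sub>1 \<union> W) = {}"
      using disj_W disj_D1 by auto
  qed (use A indep in auto)
  moreover have "d \<notin> cl \<I> A\<^sub>1" if "d \<in> D\<^sub>1" for d
    by (rule notin_cl_if_indep_Un[OF indep(3) disj_D1 that])
  then have "A\<^sub>0 \<inter> D\<^sub>1 = {}"
    using A(3) by blast
  moreover have "A\<^sub>0 \<union> W \<union> D\<^sub>0 = B\<^sub>0" "A\<^sub>0 \<union> W \<union> D\<^sub>1 = A\<^sub>0 \<union> (D\<^sub>1 \<union> W)"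
    using B0_eq by auto
  ultimately have "base_pair \<I> (A\<^sub>0 \<union> W) D\<^sub>0 D\<^sub>1"
    using B(1) B0_eq disj_W by (auto simp: base_pair_def)
  moreover have "countable D\<^sub>0" "countable D\<^sub>1"
    using K(1) D by auto
  ultimately obtain S where S: "bijection_rel (Fpow D\<^sub>0) (Fpow D\<^sub>1) S" "({}, {}) \<in> S"
    and S_base: "\<And>I J. (I, J) \<in> S \<Longrightarrow> matroid_base \<I> (A\<^sub>0 \<union> W \<union> (D\<^sub>0 - I) \<union> J)"
    using countable_base_exchange by blast
  define R' where "R' = {(I \<union> M, J \<union> N) | I J M N. (I, J) \<in> R \<and> (M, N) \<in> S}"
  have bij': "bijection_rel (Fpow (A\<^sub>0 \<union> D\<^sub>0)) (Fpow (A\<^sub>1 \<union> D\<^sub>1)) R'"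
    unfolding R'_def by (rule bijection_rel_Fpow_Un[OF bij S(1) B0_eq(3) disj_D1])
  have R'_base: "matroid_base \<I> ((B\<^sub>0 - (I \<union> M)) \<union> (J \<union> N))" if IJ: "(I, J) \<in> R" and MN: "(M, N) \<in> S"
    for I J M N
  proof -
    have sub: "I \<subseteq> A\<^sub>0" "M \<subseteq> D\<^sub>0" "N \<subseteq> D\<^sub>1"
      using bijection_rel_mem[OF bij IJ] bijection_rel_mem[OF S(1) MN] by (auto simp: Fpow_def)
    \<comment> \<open>The base obtained from \<open>S\<close> contains all of
      \<open>A\<^sub>0\<close>, which has the same span as
      \<open>(A\<^sub>0 - I) \<union> J\<close>.\<close>
    have "matroid_base \<I> (((A\<^sub>0 - I) \<union> J) \<union> (W \<union> (D\<^sub>0 - M) \<union> N))"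
    proof (rule base_replace)
      show "matroid_base \<I> (A\<^sub>0 \<union> (W \<union> (D\<^sub>0 - M) \<union> N))"
        using S_base[OF MN] by (simp add: Un_assoc)
      show "A\<^sub>0 \<inter> (W \<union> (D\<^sub>0 - M) \<union> N) = {}"
        using B0_eq \<open>A\<^sub>0 \<inter> D\<^sub>1 = {}\<close> sub by blast
    qed (use partial_exchange_spans[OF B(1) pe IJ] in blast)+
    moreover have "((A\<^sub>0 - I) \<union> J) \<union> (W \<union> (D\<^sub>0 - M) \<union> N) = (B\<^sub>0 - (I \<union> M)) \<union> (J \<union> N)"
      using B0_eq sub by blast
    ultimately show ?thesis
      by simp
  qed
  have "A\<^sub>0 \<union> D\<^sub>0 \<subseteq> B\<^sub>0" "A\<^sub>1 \<union> D\<^sub>1 \<subseteq> B\<^sub>1"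
    using A D by auto
  moreover have "\<forall>(I, J) \<in> R'. matroid_base \<I> ((B\<^sub>0 - I) \<union> J)"
    unfolding R'_def using R'_base by blast
  ultimately have "partial_exchange \<I> B\<^sub>0 B\<^sub>1 (A\<^sub>0 \<union> D\<^sub>0) (A\<^sub>1 \<union> D\<^sub>1) R'"
    using spans bij' unfolding partial_exchange_def by blast
  moreover have "R \<subseteq> R'"
  proof (rule subrelI)
    fix I J assume "(I, J) \<in> R"
    then have "(I \<union> {}, J \<union> {}) \<in> R'"
      unfolding R'_def using S(2) by blast
    then show "(I, J) \<in> R'"
      by simp
  qed
  moreover have "R' \<noteq> R"
  proof
    assume "R' = R"
    \<comment> \<open>The singleton \<open>{e}\<close> has a partner in \<open>R'\<close> but none
      in \<open>R\<close>, as \<open>e \<notin> A\<^sub>0\<close>.\<close>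
    have "{e} \<in> Fpow (A\<^sub>0 \<union> D\<^sub>0)"
      using e K(2) D by (auto simp: Fpow_def)
    then obtain J where "({e}, J) \<in> R"
      using bijection_rel_total[OF bij'] \<open>R' = R\<close> by blast
    then show False
      using bijection_rel_mem[OF bij] e by (auto simp: Fpow_def)
  qed
  ultimately show ?thesis
    by blast
qed

text \<open>Finite subsets of the united pieces already lie in the piece of one chain member, and
  any two pairs lie in a common member, so bijectivity is inherited.\<close>

lemma partial_exchange_Union:
  assumes nonempty: "\<C> \<noteq> {}" and chain: "subset.chain {R. \<exists>A\<^sub>0 A\<^sub>1. partial_exchange \<I> B\<^sub>0 B\<^sub>1 A\<^sub>0 A\<^sub>1 R} \<C>"
  shows "\<exists>A\<^sub>0 A\<^sub>1. partial_exchange \<I> B\<^sub>0 B\<^sub>1 A\<^sub>0 A\<^sub>1 (\<Union>\<C>)"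
proof -
  have "\<forall>R\<in>\<C>. \<exists>A\<^sub>0 A\<^sub>1. partial_exchange \<I> B\<^sub>0 B\<^sub>1 A\<^sub>0 A\<^sub>1 R"
    using chain by (auto simp: subset.chain_def)
  then obtain A\<^sub>0 A\<^sub>1 where pe: "\<And>R. R \<in> \<C> \<Longrightarrow> partial_exchange \<I> B\<^sub>0 B\<^sub>1 (A\<^sub>0 R) (A\<^sub>1 R) R"
    by metis
  have bij: "bijection_rel (Fpow (A\<^sub>0 R)) (Fpow (A\<^sub>1 R)) R" if "R \<in> \<C>" for R
    using pe[OF that] by (simp add: partial_exchange_def)
  have linear: "R \<subseteq> R' \<or> R' \<subseteq> R" if "R \<in> \<C>" "R' \<in> \<C>" for R R'
    using chain that by (auto simp: subset.chain_def)
  \<comment> \<open>Although the pieces are merely chosen, the relation determines them: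
    \<open>x\<close> lies in a piece exactly when \<open>{x}\<close> has a partner.\<close>
  have mono: "A\<^sub>0 R \<subseteq> A\<^sub>0 R' \<and> A\<^sub>1 R \<subseteq> A\<^sub>1 R'" if "R \<in> \<C>" "R' \<in> \<C>" "R \<subseteq> R'" for R R'
  proof -
    have "x \<in> A\<^sub>0 R'" if "x \<in> A\<^sub>0 R" for x
    proof -
      have "{x} \<in> Fpow (A\<^sub>0 R)"
        using that by (auto simp: Fpow_def)
      then obtain J where "({x}, J) \<in> R'"
        using bijection_rel_total[OF bij[OF \<open>R \<in> \<C>\<close>]] \<open>R \<subseteq> R'\<close> by blast
      then show ?thesis
        using bijection_rel_mem[OF bij[OF \<open>R' \<in> \<C>\<close>]] by (auto simp: Fpow_def)
    qed
    moreover have "x \<in> A\<^sub>1 R'" if "x \<in> A\<^sub>1 R" for x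
    proof -
      have "{x} \<in> Fpow (A\<^sub>1 R)"
        using that by (auto simp: Fpow_def)
      then obtain I where "(I, {x}) \<in> R'"
        using bijection_rel_surjective[OF bij[OF \<open>R \<in> \<C>\<close>]] \<open>R \<subseteq> R'\<close> by blast
      then show ?thesis
        using bijection_rel_mem[OF bij[OF \<open>R' \<in> \<C>\<close>]] by (auto simp: Fpow_def)
    qed
    ultimately show ?thesis
      by blast
  qed
  have in_member: "\<exists>R\<in>\<C>. I \<in> Fpow (A R)"
    if "I \<in> Fpow (\<Union>R\<in>\<C>. A R)" and "\<And>R R'. R \<in> \<C> \<Longrightarrow> R' \<in> \<C> \<Longrightarrow> R \<subseteq> R' \<Longrightarrow> A R \<subseteq> A R'"
    for I and A :: "('a set \<times> 'a set) set \<Rightarrow> 'a set"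
  proof -
    have "subset.chain UNIV (A ` \<C>)"
      using linear that(2) by (fastforce simp: subset.chain_def)
    moreover have "finite I" "I \<subseteq> \<Union>(A ` \<C>)"
      using that(1) by (auto simp: Fpow_def)
    ultimately obtain T where "T \<in> A ` \<C>" "I \<subseteq> T"
      using finite_subset_Union_chain[of I "A ` \<C>" UNIV] nonempty by auto
    then show ?thesis
      using \<open>finite I\<close> by (auto simp: Fpow_def)
  qed
  have common: "\<exists>R\<in>\<C>. a \<in> R \<and> b \<in> R" if "a \<in> \<Union>\<C>" "b \<in> \<Union>\<C>" for a b
    using that linear by blast
  have "bijection_rel (Fpow (\<Union>R\<in>\<C>. A\<^sub>0 R)) (Fpow (\<Union>R\<in>\<C>. A\<^sub>1 R)) (\<Union>\<C>)"
  proof (rule bijection_relI)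
    fix I J
    show "I \<in> Fpow (\<Union>R\<in>\<C>. A\<^sub>0 R) \<and> J \<in> Fpow (\<Union>R\<in>\<C>. A\<^sub>1 R)" if IJ: "(I, J) \<in> \<Union>\<C>"
    proof -
      obtain R where "R \<in> \<C>" "(I, J) \<in> R"
        using IJ by blast
      then show ?thesis
        using bijection_rel_mem[OF bij] by (fastforce simp: Fpow_def)
    qed
    show "\<exists>J. (I, J) \<in> \<Union>\<C>" if I: "I \<in> Fpow (\<Union>R\<in>\<C>. A\<^sub>0 R)"
    proof -
      obtain R where "R \<in> \<C>" "I \<in> Fpow (A\<^sub>0 R)"
        using in_member[OF I] mono by blast
      then show ?thesis
        using bijection_rel_total[OF bij] by blast
    qed
    show "\<exists>I. (I, J) \<in> \<Union>\<C>" if J: "J \<in> Fpow (\<Union>R\<in>\<C>. A\<^sub>1 R)"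
    proof -
      obtain R where "R \<in> \<C>" "J \<in> Fpow (A\<^sub>1 R)"
        using in_member[OF J] mono by blast
      then show ?thesis
        using bijection_rel_surjective[OF bij] by blast
    qed
    show "J = J'" if J: "(I, J) \<in> \<Union>\<C>" "(I, J') \<in> \<Union>\<C>" for J'
      using common[OF J] bijection_rel_functional[OF bij] by blast
    show "I = I'" if I: "(I, J) \<in> \<Union>\<C>" "(I', J) \<in> \<Union>\<C>" for I'
      using common[OF I] bijection_rel_injective[OF bij] by blast
  qed
  moreover have "(\<Union>R\<in>\<C>. A\<^sub>0 R) \<subseteq> B\<^sub>0" "(\<Union>R\<in>\<C>. A\<^sub>1 R) \<subseteq> B\<^sub>1"
    "\<forall>(I, J) \<in> \<Union>\<C>. matroid_base \<I> ((B\<^sub>0 - I) \<union> J)"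
    using pe unfolding partial_exchange_def by blast+
  moreover have "(\<Union>R\<in>\<C>. A\<^sub>0 R) \<subseteq> cl \<I> (\<Union>R\<in>\<C>. A\<^sub>1 R)"
  proof (rule UN_least)
    fix R assume R: "R \<in> \<C>"
    show "A\<^sub>0 R \<subseteq> cl \<I> (\<Union>R\<in>\<C>. A\<^sub>1 R)"
      using pe[OF R] cl_mono[of "A\<^sub>1 R" "\<Union>R\<in>\<C>. A\<^sub>1 R"] R unfolding partial_exchange_def by blast
  qed
  moreover have "(\<Union>R\<in>\<C>. A\<^sub>1 R) \<subseteq> cl \<I> (\<Union>R\<in>\<C>. A\<^sub>0 R)"
  proof (rule UN_least)
    fix R assume R: "R \<in> \<C>"
    show "A\<^sub>1 R \<subseteq> cl \<I> (\<Union>R\<in>\<C>. A\<^sub>0 R)"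
      using pe[OF R] cl_mono[of "A\<^sub>0 R" "\<Union>R\<in>\<C>. A\<^sub>0 R"] R unfolding partial_exchange_def by blast
  qed
  ultimately show ?thesis
    unfolding partial_exchange_def by blast
qed

text \<open>A maximal partial exchange has \<open>A\<^sub>0 = B\<^sub>0\<close> by
  \<open>partial_exchange_extend\<close>. Then \<open>A\<^sub>1\<close> spans
  \<open>B\<^sub>0\<close>, so it is itself a base and cannot be a proper subset of
  \<open>B\<^sub>1\<close>.\<close>

lemma full_exchange:
  assumes B: "matroid_base \<I> B\<^sub>0" "matroid_base \<I> B\<^sub>1"
  obtains R where "bijection_rel (Fpow B\<^sub>0) (Fpow B\<^sub>1) R"
    "\<And>I J. (I, J) \<in> R \<Longrightarrow> matroid_base \<I> ((B\<^sub>0 - I) \<union> J)"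
proof -
  define \<P> where "\<P> = {R. \<exists>A\<^sub>0 A\<^sub>1. partial_exchange \<I> B\<^sub>0 B\<^sub>1 A\<^sub>0 A\<^sub>1 R}"
  have "\<exists>M\<in>\<P>. \<forall>X\<in>\<P>. M \<subseteq> X \<longrightarrow> X = M"
  proof (rule subset_Zorn_nonempty)
    show "\<P> \<noteq> {}"
      using partial_exchange_empty[OF B(1)] by (auto simp: \<P>_def)
    show "\<Union>\<C> \<in> \<P>" if "\<C> \<noteq> {}" "subset.chain \<P> \<C>" for \<C>
      using partial_exchange_Union[OF that[unfolded \<P>_def]] by (simp add: \<P>_def)
  qed
  then obtain R where "R \<in> \<P>" and max: "\<And>R'. R' \<in> \<P> \<Longrightarrow> \<not> R \<subset> R'"
    by blast
  then obtain A\<^sub>0 A\<^sub>1 where R: "partial_exchange \<I> B\<^sub>0 B\<^sub>1 A\<^sub>0 A\<^sub>1 R"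
    by (auto simp: \<P>_def)
  have A: "A\<^sub>0 \<subseteq> B\<^sub>0" "A\<^sub>1 \<subseteq> B\<^sub>1" "A\<^sub>0 \<subseteq> cl \<I> A\<^sub>1"
    using R by (auto simp: partial_exchange_def)
  have A0: "A\<^sub>0 = B\<^sub>0"
  proof (rule ccontr)
    assume "A\<^sub>0 \<noteq> B\<^sub>0"
    then obtain e where "e \<in> B\<^sub>0 - A\<^sub>0"
      using A(1) by blast
    then obtain R' where "R' \<in> \<P>" "R \<subset> R'"
      using partial_exchange_extend[OF B R] unfolding \<P>_def by blast
    then show False
      using max by blast
  qed
  have A1I: "A\<^sub>1 \<in> \<I>"
    using indep_downward_closed[OF matroid_base_indep[OF B(2)] A(2)] .
  have "cl \<I> B\<^sub>0 \<subseteq> cl \<I> A\<^sub>1"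
    using cl_trans[OF A1I matroid_base_indep[OF B(1)]] A(3) A0 by simp
  then have "matroid_base \<I> A\<^sub>1"
    using B(1) A1I by (auto simp: matroid_base_iff_cl)
  then have "A\<^sub>1 = B\<^sub>1"
    using A(2) matroid_base_indep[OF B(2)] by (auto simp: matroid_base_def)
  then show ?thesis
    using that[of R] R A0 unfolding partial_exchange_def by blast
qed

end

theorem theorem1p5:
  fixes E :: "'a set" and \<I> :: "'a set set" and B\<^sub>0 B\<^sub>1 :: "'a set"
  assumes "finitary_matroid E \<I>"
    and "matroid_base \<I> B\<^sub>0"
    and "matroid_base \<I> B\<^sub>1"
  shows "\<exists>F. bij_betw F (Fpow B\<^sub>0) (Fpow B\<^sub>1) \<and>
    (\<forall>I \<in> Fpow B\<^sub>0. matroid_base \<I> ((B\<^sub>0 - I) \<union> F I))"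
proof -
  obtain R where R: "bijection_rel (Fpow B\<^sub>0) (Fpow B\<^sub>1) R"
    and base: "\<And>I J. (I, J) \<in> R \<Longrightarrow> matroid_base \<I> ((B\<^sub>0 - I) \<union> J)"
    using finitary_matroid.full_exchange[OF assms] by blast
  obtain F where "bij_betw F (Fpow B\<^sub>0) (Fpow B\<^sub>1)" "\<And>I. I \<in> Fpow B\<^sub>0 \<Longrightarrow> (I, F I) \<in> R"
    using bijection_rel_imp_bij_betw[OF R] by blast
  then show ?thesis
    using base by blast
qed

end
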